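(* Fix a finite compatible spatial discretization, $C\in[C_-,C_+]$ and $T>0$. For every $0<\delta\le\delta_0$, let $U_0^\delta$ have no fast or transverse component, equivalently $U_0^\delta=\Pi_s(\delta)U_0^\delta$ on every coupled block (with zero component in $\{0\}\times\ker G_h^*$), and assume $\sup_\delta\|U_0^\delta\|<\infty$. Then, for sufficiently small $\Delta t$, $$\max_{0\le n\Delta t\le T}\|R(\Delta tA_{h,\delta})^nU_0^\delta-e^{t_nA_{h,\delta}}U_0^\delta\|\le K_{h,T}\,\Delta t^4\,\|U_0^\delta\|,\qquad t_n=n\Delta t,$$ with a constant $K_{h,T}$ independent of $0<\delta\le\delta_0$ (and of $\Delta t$).
   Context: A finite compatible spatial discretization consists of finite-dimensional Hilbert spaces $X_h,Q_h$, a constant $a>0$, and linear maps $G_h:X_h\to Q_h$, $D_h:Q_h\to X_h$ with $D_h=-G_h^*$. On $X_h\times Q_h$ put $$A_{h,\delta}=\begin{bmatrix}0&-D_h\\-(a/\delta)G_h&-(1/\delta)I\end{bmatrix}.$$ By a singular-value decomposition of $G_h$ with positive singular values $\sigma_1,\dots,\sigma_r$, $A_{h,\delta}$ is the orthogonal direct sum of zero blocks on $\ker G_h\times\{0\}$, scalar blocks $-1/\delta$ on $\{0\}\times\ker G_h^*$ (the transverse components), and coupled blocks $B_{j,\delta}=\begin{bmatrix}0&\sigma_j\\-a\sigma_j/\delta&-1/\delta\end{bmatrix}$ acting on the coefficients of the $j$-th pair of right/left singular vectors. The number $\delta_0>0$ is fixed with $4a\delta_0\sigma_{\max}^2<1$,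 where $\sigma_{\max}=\max_j\sigma_j$, so that for $0<\delta\le\delta_0$ each block has distinct real eigenvalues $$\lambda_{s,j}=\frac{-1+\sqrt{1-4a\delta\sigma_j^2}}{2\delta}\ (\text{slow}),\qquad\lambda_{f,j}=\frac{-1-\sqrt{1-4a\delta\sigma_j^2}}{2\delta}\ (\text{fast}).$$ On the $j$-th block $\Pi_s(\delta)=\frac{B_{j,\delta}-\lambda_{f,j}I}{\lambda_{s,j}-\lambda_{f,j}}$ is the slow spectral projector and $I-\Pi_s(\delta)$ the fast one. Set $C_\pm=\frac{25\pm\sqrt{105}}{780}$, $a_0=\frac16+\frac72C$, $a_1=\frac23-10C$, $a_2=\frac16+\frac{13}2C$, $H(z)=\frac{1+z/4+z^2/48}{1-z/4+z^2/48}$ and $R(z)=\frac{1+a_0z+Cz^2+(a_1z-Cz^2)H(z)}{1-a_2z+\frac32Cz^2}$; $R(M)$ is the rational function of the operator $M$. *)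

theory Defs
  imports "HOL-Analysis.Analysis"
begin

definition compatible_discretization ::
    "('x::euclidean_space \<Rightarrow> 'q::euclidean_space) \<Rightarrow> ('q \<Rightarrow> 'x) \<Rightarrow> real \<Rightarrow> bool" where
  "compatible_discretization G D a \<longleftrightarrow>
     linear G \<and> linear D \<and> 0 < a \<and> D = (\<lambda>q. - adjoint G q)"

definition A_op ::
    "('x::euclidean_space \<Rightarrow> 'q::euclidean_space) \<Rightarrow> ('q \<Rightarrow> 'x) \<Rightarrow> real \<Rightarrow> real
      \<Rightarrow> 'x \<times> 'q \<Rightarrow> 'x \<times> 'q" where
  "A_op G D a \<delta> = (\<lambda>(x, q). (- D q, - (a / \<delta>) *\<^sub>R G x - (1 / \<delta>) *\<^sub>R q))"

text \<open>
  Reduced singular value decomposition: \<open>\<sigma> j\<close>, \<open>v j\<close>, \<open>w j\<close> for \<open>j < r\<close> are the positive singular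
  values and the right and left singular vectors.  Values at \<open>j \<ge> r\<close> are irrelevant.  The lemma
  \<open>svd_exists\<close> below shows that every linear map has one.
\<close>

definition is_svd ::
    "('x::euclidean_space \<Rightarrow> 'q::euclidean_space) \<Rightarrow> nat \<Rightarrow> (nat \<Rightarrow> real)
      \<Rightarrow> (nat \<Rightarrow> 'x) \<Rightarrow> (nat \<Rightarrow> 'q) \<Rightarrow> bool" where
  "is_svd G r \<sigma> v w \<longleftrightarrow>
     (\<forall>j<r. 0 < \<sigma> j) \<and>
     (\<forall>i<r. \<forall>j<r. v i \<bullet> v j = (if i = j then 1 else 0)) \<and>
     (\<forall>i<r. \<forall>j<r. w i \<bullet> w j = (if i = j then 1 else 0)) \<and>
     (\<forall>x. G x = (\<Sum>j<r. (\<sigma> j * (x \<bullet> v j)) *\<^sub>R w j))"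

text \<open>The inserted \<open>0\<close> only matters for \<open>r = 0\<close>, that is \<open>G = 0\<close>.\<close>

definition sigma_max :: "nat \<Rightarrow> (nat \<Rightarrow> real) \<Rightarrow> real" where
  "sigma_max r \<sigma> = Max (insert 0 (\<sigma> ` {..<r}))"

definition block :: "real \<Rightarrow> real \<Rightarrow> real \<Rightarrow> real^2^2" where
  "block a \<delta> s = vector [vector [0, s], vector [- (a * s / \<delta>), - (1 / \<delta>)]]"

definition lambda_slow :: "real \<Rightarrow> real \<Rightarrow> real \<Rightarrow> real" where
  "lambda_slow a \<delta> s = (- 1 + sqrt (1 - 4 * a * \<delta> * s\<^sup>2)) / (2 * \<delta>)"

definition lambda_fast :: "real \<Rightarrow> real \<Rightarrow> real \<Rightarrow> real" where
  "lambda_fast a \<delta> s = (- 1 - sqrt (1 - 4 * a * \<delta> * s\<^sup>2)) / (2 * \<delta>)"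

definition slow_projector :: "real \<Rightarrow> real \<Rightarrow> real \<Rightarrow> real^2^2" where
  "slow_projector a \<delta> s =
     (1 / (lambda_slow a \<delta> s - lambda_fast a \<delta> s)) *\<^sub>R
       (block a \<delta> s - lambda_fast a \<delta> s *\<^sub>R mat 1)"

text \<open>
  No transverse component: \<open>snd U\<close> is orthogonal to the kernel of the adjoint of \<open>G\<close>.  No fast
  component: on each coupled block the slow projector fixes the pair of coefficients of \<open>U\<close> along
  \<open>(v j, 0)\<close> and \<open>(0, w j)\<close>.  The component of \<open>fst U\<close> in the kernel of \<open>G\<close> is unrestricted.
\<close>

definition slow_data ::
    "('x::euclidean_space \<Rightarrow> 'q::euclidean_space) \<Rightarrow> nat \<Rightarrow> (nat \<Rightarrow> real)
      \<Rightarrow> (nat \<Rightarrow> 'x) \<Rightarrow> (nat \<Rightarrow> 'q) \<Rightarrow> real \<Rightarrow> real \<Rightarrow> 'x \<times> 'q \<Rightarrow> bool" where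
  "slow_data G r \<sigma> v w a \<delta> U \<longleftrightarrow>
     snd U \<in> orthogonal_comp {q. adjoint G q = 0} \<and>
     (\<forall>j<r. slow_projector a \<delta> (\<sigma> j) *v vector [fst U \<bullet> v j, snd U \<bullet> w j]
              = vector [fst U \<bullet> v j, snd U \<bullet> w j])"

definition C_minus :: real where "C_minus = (25 - sqrt 105) / 780"
definition C_plus :: real where "C_plus = (25 + sqrt 105) / 780"

definition a0 :: "real \<Rightarrow> real" where "a0 C = 1/6 + 7/2 * C"
definition a1 :: "real \<Rightarrow> real" where "a1 C = 2/3 - 10 * C"
definition a2 :: "real \<Rightarrow> real" where "a2 C = 1/6 + 13/2 * C"

text \<open>
  The rational functions \<open>H\<close> and \<open>R\<close> evaluated at a linear operator \<open>M\<close>: a denominator becomes the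
  inverse function of the corresponding polynomial in \<open>M\<close>, which is meaningful when that polynomial
  is a bijection.  All factors commute, so their order is immaterial.
\<close>

definition H_op :: "('v::real_vector \<Rightarrow> 'v) \<Rightarrow> 'v \<Rightarrow> 'v" where
  "H_op M =
     inv (\<lambda>u. u - (1/4) *\<^sub>R M u + (1/48) *\<^sub>R M (M u)) \<circ>
     (\<lambda>u. u + (1/4) *\<^sub>R M u + (1/48) *\<^sub>R M (M u))"

definition R_op :: "real \<Rightarrow> ('v::real_vector \<Rightarrow> 'v) \<Rightarrow> 'v \<Rightarrow> 'v" where
  "R_op C M =
     inv (\<lambda>u. u - a2 C *\<^sub>R M u + (3/2 * C) *\<^sub>R M (M u)) \<circ>
     (\<lambda>u. u + a0 C *\<^sub>R M u + C *\<^sub>R M (M u)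
            + (a1 C *\<^sub>R M (H_op M u) - C *\<^sub>R M (M (H_op M u))))"

definition exp_op :: "('v::real_normed_vector \<Rightarrow> 'v) \<Rightarrow> 'v \<Rightarrow> 'v" where
  "exp_op M u = (\<Sum>n. (1 / fact n) *\<^sub>R (M ^^ n) u)"

lemma svd_exists:
  fixes G :: "'x::euclidean_space \<Rightarrow> 'q::euclidean_space"
  assumes "linear G"
  shows "\<exists>r \<sigma> v w. is_svd G r \<sigma> v w"
  using assms
proof (induction "dim (range G)" arbitrary: G rule: less_induct)
  case less
  interpret G: linear G by fact
  show ?case
  proof (cases "\<forall>x. G x = 0")
    case True
    then have "is_svd G 0 (\<lambda>_. 0) (\<lambda>_. 0) (\<lambda>_. 0)" by (simp add: is_svd_def)
    then show ?thesis by blast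
  next
    case False
    have "continuous_on (sphere 0 1) (\<lambda>x. norm (G x))"
      by (intro continuous_intros linear_continuous_on linear_conv_bounded_linear[THEN iffD1] less.prems)
    then obtain v0 where v0: "norm v0 = 1" and mx: "\<And>x. norm x = 1 \<Longrightarrow> norm (G x) \<le> norm (G v0)"
      using continuous_attains_sup[of "sphere 0 1" "\<lambda>x. norm (G x)"] by fastforce
    define s where "s = norm (G v0)"
    have bd: "norm (G x) \<le> s * norm x" for x
    proof (cases "x = 0")
      case False
      then show ?thesis
        using mx[of "(1 / norm x) *\<^sub>R x"] by (simp add: s_def G.scale field_simps)
    qed (simp add: G.zero)
    have s: "s > 0"
      using False bd by (metis norm_ge_zero norm_le_zero_iff not_less mult_le_0_iff order_trans less_le s_def)
    have vv: "v0 \<bullet> v0 = 1" using v0 by (simp add: dot_square_norm)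
    define w0 where "w0 = (1 / s) *\<^sub>R G v0"
    have Gv: "G v0 = s *\<^sub>R w0" using s by (simp add: w0_def)
    have ww: "w0 \<bullet> w0 = 1"
      using s by (simp add: w0_def s_def dot_square_norm)
    have orth: "G v0 \<bullet> G u = 0" if "v0 \<bullet> u = 0" for u
    proof (rule ccontr)
      define p where "p = G v0 \<bullet> G u"
      assume "G v0 \<bullet> G u \<noteq> 0"
      then have p: "p \<noteq> 0" by (simp add: p_def)
      define c where "c = 1 + s\<^sup>2 * (u \<bullet> u)"
      have c: "c > 0" unfolding c_def by (rule add_pos_nonneg) auto
      define t where "t = p / c"
      have "(norm (G (v0 + t *\<^sub>R u)))\<^sup>2 \<le> (s * norm (v0 + t *\<^sub>R u))\<^sup>2"
        by (intro power_mono bd) auto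
      then have "(G v0 + t *\<^sub>R G u) \<bullet> (G v0 + t *\<^sub>R G u)
          \<le> s\<^sup>2 * ((v0 + t *\<^sub>R u) \<bullet> (v0 + t *\<^sub>R u))"
        by (simp add: power_mult_distrib power2_norm_eq_inner G.add G.scale)
      moreover have "(G v0 + t *\<^sub>R G u) \<bullet> (G v0 + t *\<^sub>R G u) = s\<^sup>2 + 2 * t * p + t\<^sup>2 * (G u \<bullet> G u)"
        by (simp add: s_def power2_norm_eq_inner) (simp add: algebra_simps inner_commute p_def power2_eq_square)
      moreover have "s\<^sup>2 * ((v0 + t *\<^sub>R u) \<bullet> (v0 + t *\<^sub>R u)) = s\<^sup>2 + t\<^sup>2 * (s\<^sup>2 * (u \<bullet> u))"
        using that vv by (simp add: algebra_simps inner_commute power2_eq_square)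
      moreover have "t\<^sup>2 * (G u \<bullet> G u) \<ge> 0" by simp
      moreover have "t\<^sup>2 * (s\<^sup>2 * (u \<bullet> u)) \<le> t\<^sup>2 * c"
        by (intro mult_left_mono) (auto simp: c_def)
      moreover have "t\<^sup>2 * c = t * p" using c by (simp add: t_def power2_eq_square)
      moreover have "t * p > 0" using c p by (auto simp: t_def zero_less_divide_iff zero_less_mult_iff)
      ultimately show False by linarith
    qed
    define G' where "G' = (\<lambda>x. G (x - (x \<bullet> v0) *\<^sub>R v0))"
    have G'_eq: "G' x = G x - (s * (x \<bullet> v0)) *\<^sub>R w0" for x
      by (simp add: G'_def G.diff G.scale Gv)
    have lin': "linear G'"
      by (rule linearI) (simp_all add: G'_eq G.add G.scale algebra_simps)
    have w0G': "w0 \<bullet> G' x = 0" for x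
    proof -
      have "v0 \<bullet> (x - (x \<bullet> v0) *\<^sub>R v0) = 0" by (simp add: inner_diff_right vv inner_commute)
      from orth[OF this] show ?thesis by (simp add: w0_def G'_def)
    qed
    have "range G' \<subset> range G"
    proof
      show "range G' \<subseteq> range G" by (auto simp: G'_def)
      have "G v0 \<notin> range G'"
      proof
        assume "G v0 \<in> range G'"
        then have "w0 \<bullet> G v0 = 0" using w0G' by auto
        then show False using s ww by (simp add: Gv)
      qed
      then show "range G' \<noteq> range G" by blast
    qed
    moreover have "span (range G') = range G'" "span (range G) = range G"
      using linear_subspace_image[OF lin' subspace_UNIV] linear_subspace_image[OF less.prems subspace_UNIV]
      by (simp_all add: span_eq_iff)
    ultimately have "dim (range G') < dim (range G)" by (metis dim_psubset)
    from less.hyps[OF this lin'] obtain r \<sigma> v w where svd: "is_svd G' r \<sigma> v w" by blast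
    have pos: "\<And>j. j < r \<Longrightarrow> \<sigma> j > 0"
      and ov: "\<And>i j. i < r \<Longrightarrow> j < r \<Longrightarrow> v i \<bullet> v j = (if i = j then 1 else 0)"
      and ow: "\<And>i j. i < r \<Longrightarrow> j < r \<Longrightarrow> w i \<bullet> w j = (if i = j then 1 else 0)"
      and rep: "\<And>x. G' x = (\<Sum>j<r. (\<sigma> j * (x \<bullet> v j)) *\<^sub>R w j)"
      using svd by (auto simp: is_svd_def)
    have coef: "w i \<bullet> G' x = \<sigma> i * (x \<bullet> v i)" if "i < r" for i x
    proof -
      have "w i \<bullet> G' x = (\<Sum>j<r. (\<sigma> j * (x \<bullet> v j)) * (w i \<bullet> w j))"
        by (simp add: rep inner_sum_right)
      also have "\<dots> = (\<Sum>j<r. if i = j then \<sigma> j * (x \<bullet> v j) else 0)"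
        by (intro sum.cong) (use that ow in auto)
      finally show ?thesis using that by simp
    qed
    have ov0: "v0 \<bullet> v i = 0" "v i \<bullet> v0 = 0" if "i < r" for i
    proof -
      have "G' v0 = 0" by (simp add: G'_def vv G.zero)
      with coef[OF that, of v0] pos[OF that] show "v0 \<bullet> v i = 0" by simp
      then show "v i \<bullet> v0 = 0" by (simp add: inner_commute)
    qed
    have ow0: "w0 \<bullet> w i = 0" "w i \<bullet> w0 = 0" if "i < r" for i
    proof -
      have "G' (v i) = (\<Sum>j<r. if i = j then \<sigma> j *\<^sub>R w j else 0)"
        unfolding rep by (intro sum.cong) (use that ov in auto)
      then have "G' (v i) = \<sigma> i *\<^sub>R w i" using that by simp
      with w0G'[of "v i"] pos[OF that] show "w0 \<bullet> w i = 0" by simp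
      then show "w i \<bullet> w0 = 0" by (simp add: inner_commute)
    qed
    have "is_svd G (Suc r) (\<sigma>(r := s)) (v(r := v0)) (w(r := w0))"
      unfolding is_svd_def
    proof (intro conjI allI impI)
      fix x
      have "G x = G' x + (s * (x \<bullet> v0)) *\<^sub>R w0" by (simp add: G'_eq)
      then show "G x = (\<Sum>j<Suc r. ((\<sigma>(r := s)) j * (x \<bullet> (v(r := v0)) j)) *\<^sub>R (w(r := w0)) j)"
        by (simp add: rep)
    qed (auto simp: less_Suc_eq pos s ov ow ov0 ow0 vv ww)
    then show ?thesis by blast
  qed
qed

end

theory Submission
  imports Defs
begin

text \<open>
  Slow data is a sum of eigenvectors of \<open>A\<close> whose eigenvalues lie in \<open>[- 2 a \<sigma>\<^sub>m\<^sub>a\<^sub>x\<^sup>2, 0]\<close>, a range that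
  does not depend on \<open>\<delta>\<close>.  On each of them the claim is the classical convergence estimate for the
  scalar equation, with \<open>R z - exp z = O(z^5)\<close>.  The stiff part of the spectrum only enters through
  the invertibility of the denominators; this follows from the dissipativity of \<open>A\<close> in the
  energy inner product \<open>(a / \<delta>) x \<bullet> x' + q \<bullet> q'\<close>, because both denominators have the form
  \<open>1 - b z + c z\<^sup>2\<close> with \<open>b > 0\<close> and \<open>c \<ge> 0\<close>.
\<close>

section \<open>Scalar consistency and convergence for nonpositive arguments\<close>

definition H_fun :: "real \<Rightarrow> real" where
  "H_fun z = (1 + z/4 + z\<^sup>2/48) / (1 - z/4 + z\<^sup>2/48)"

definition R_fun :: "real \<Rightarrow> real \<Rightarrow> real" where
  "R_fun C z = (1 + a0 C * z + C * z\<^sup>2 + (a1 C * z - C * z\<^sup>2) * H_fun z) /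
     (1 - a2 C * z + 3/2 * C * z\<^sup>2)"

lemma quadratic_ge_1:
  fixes b c z :: real
  assumes "0 \<le> b" "0 \<le> c" "z \<le> 0"
  shows "1 \<le> 1 - b * z + c * z\<^sup>2"
  using mult_nonneg_nonpos[OF assms(1,3)] mult_nonneg_nonneg[OF assms(2), of "z\<^sup>2"] by simp

lemma H_denominator_ge_1: "z \<le> 0 \<Longrightarrow> 1 \<le> 1 - z/4 + z\<^sup>2/48" for z :: real
  using quadratic_ge_1[of "1/4" "1/48" z] by simp

lemma R_denominator_ge_1: "0 \<le> C \<Longrightarrow> z \<le> 0 \<Longrightarrow> 1 \<le> 1 - a2 C * z + 3/2 * C * z\<^sup>2"
  by (rule quadratic_ge_1) (auto simp: a2_def)

text \<open>Both scalar denominators are at least 1 for \<open>z \<le> 0\<close>, so this discards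
  them from the error quotients.\<close>

lemma abs_divide_le:
  fixes x y :: real
  assumes "1 \<le> y"
  shows "\<bar>x / y\<bar> \<le> \<bar>x\<bar>"
  using assms mult_left_mono[OF assms abs_ge_zero[of x]] by (simp add: field_simps)

text \<open>The Lagrange remainder is \<open>exp t / 120 * z^5\<close> with
  \<open>\<bar>t\<bar> \<le> 1\<close>; the constant 1 is a crude bound for
  \<open>exp t / 120\<close>.\<close>

lemma exp_Taylor_4:
  fixes z :: real
  assumes "-1 \<le> z" "z \<le> 0"
  shows "\<bar>exp z - (1 + z + z^2/2 + z^3/6 + z^4/24)\<bar> \<le> \<bar>z\<bar>^5"
proof -
  obtain t where t: "\<bar>t\<bar> \<le> \<bar>z\<bar>" and e: "exp z = (\<Sum>m<5. z^m / fact m) + exp t / fact 5 * z^5"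
    using Maclaurin_exp_le[of z 5] by blast
  have "exp t \<le> exp 1" using t assms by simp
  then have "exp t \<le> 3" using exp_le by linarith
  then have "exp t / fact 5 \<le> 1" by (simp add: fact_numeral)
  then have "exp t / fact 5 * \<bar>z\<bar>^5 \<le> 1 * \<bar>z\<bar>^5" by (intro mult_right_mono) auto
  moreover have "(\<Sum>m<5. z^m / fact m) = 1 + z + z^2/2 + z^3/6 + z^4/24"
    by (simp add: lessThan_nat_numeral lessThan_Suc fact_numeral)
  ultimately show ?thesis using e by (simp add: abs_mult power_abs)
qed

text \<open>\<open>H_fun\<close> is the diagonal (2,2) Pade approximant of \<open>exp (z/2)\<close>,
  so it shares the Taylor polynomial of \<open>exp (z/2)\<close> through degree 4. Multiplying by
  the denominator turns the error into an explicit multiple of \<open>z^5\<close>.\<close>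

lemma H_fun_Taylor_4:
  assumes "-1 \<le> z" "z \<le> 0"
  shows "\<bar>H_fun z - (1 + z/2 + z^2/8 + z^3/48 + z^4/384)\<bar> \<le> \<bar>z\<bar>^5"
proof -
  let ?q = "1 - z/4 + z^2/48"
  have q: "1 \<le> ?q" using assms by (intro H_denominator_ge_1)
  have poly: "(1 + z/4 + z^2/48) - ?q * (1 + z/2 + z^2/8 + z^3/48 + z^4/384) = z^5 * (1/4608 - z/18432)"
    by (simp add: field_simps eval_nat_numeral)
  have "x / y - s = (x - y * s) / y" if "1 \<le> y" for x y s :: real
    using that by (simp add: diff_divide_distrib)
  from this[OF q]
  have "H_fun z - (1 + z/2 + z^2/8 + z^3/48 + z^4/384) = (z^5 * (1/4608 - z/18432)) / ?q"
    unfolding H_fun_def poly[symmetric] .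
  then have "\<bar>H_fun z - (1 + z/2 + z^2/8 + z^3/48 + z^4/384)\<bar> \<le> \<bar>z^5 * (1/4608 - z/18432)\<bar>"
    using abs_divide_le[OF q] by simp
  also have "\<dots> \<le> \<bar>z\<bar>^5 * 1"
    unfolding abs_mult power_abs by (intro mult_left_mono) (use assms in auto)
  finally show ?thesis by simp
qed

text \<open>For every \<open>C\<close>, the coefficients \<open>a0\<close>, \<open>a1\<close>,
  \<open>a2\<close> make all terms of degree at most 4 cancel in numerator minus denominator times
  \<open>exp\<close>, once \<open>H_fun\<close> and \<open>exp\<close> are replaced by their Taylor
  polynomials \<open>S\<close> and \<open>E\<close>. The constant 30 rounds up 2 + 12 + 12: the
  polynomial residual, plus the two replacement errors weighted by \<open>?n1\<close> and
  \<open>?d\<close>.\<close>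

lemma R_fun_consistency:
  assumes C: "0 \<le> C" "C \<le> 1" and z: "-1 \<le> z" "z \<le> 0"
  shows "\<bar>R_fun C z - exp z\<bar> \<le> 30 * \<bar>z\<bar>^5"
proof -
  let ?d = "1 - a2 C * z + 3/2 * C * z^2"
  let ?n0 = "1 + a0 C * z + C * z^2" and ?n1 = "a1 C * z - C * z^2"
  define S where "S = 1 + z/2 + z^2/8 + z^3/48 + z^4/384"
  define E where "E = 1 + z + z^2/2 + z^3/6 + z^4/24"
  \<comment> \<open>The surviving coefficients of \<open>z^5\<close> and \<open>z^6\<close> in the
    polynomial residual, with \<open>z^5\<close> factored out.\<close>
  define p where "p = (a1 C / 384 - C/48 + a2 C / 24 - C/4) - z * (C/384 + C/16)"
  have poly: "?n0 + ?n1 * S - ?d * E = z^5 * p"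
    unfolding S_def E_def p_def a0_def a1_def a2_def by (simp add: field_simps eval_nat_numeral)
  have d: "1 \<le> ?d" using C z by (intro R_denominator_ge_1)
  have z2: "0 \<le> z^2" "z^2 \<le> 1" using z by (auto simp: abs_square_le_1)
  have Cz2: "0 \<le> C * z^2" "C * z^2 \<le> 1" using C z2 by (auto intro: mult_le_one)
  have Cz: "0 \<le> C * -z" "C * -z \<le> 1"
    using C z mult_nonneg_nonneg[of C "-z"] mult_le_one[of C "-z"] by auto
  have "p = 5/576 - 5/192 * C + 25/384 * (C * -z)"
    unfolding p_def a1_def a2_def by (simp add: field_simps)
  then have p: "\<bar>p\<bar> \<le> 2" using C Cz by linarith
  have n1: "\<bar>?n1\<bar> \<le> 12"
  proof -
    have "?n1 = 2/3 * z + 10 * (C * -z) - C * z^2" by (simp add: a1_def algebra_simps)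
    then show ?thesis using Cz Cz2 z by linarith
  qed
  have d': "\<bar>?d\<bar> \<le> 12"
  proof -
    have "?d = 1 - z/6 + 13/2 * (C * -z) + 3/2 * (C * z^2)" by (simp add: a2_def algebra_simps)
    then show ?thesis using Cz Cz2 z by linarith
  qed
  have "R_fun C z - exp z = (?n0 + ?n1 * H_fun z - ?d * exp z) / ?d"
    using d by (simp add: R_fun_def diff_divide_distrib)
  then have "\<bar>R_fun C z - exp z\<bar> \<le> \<bar>?n0 + ?n1 * H_fun z - ?d * exp z\<bar>"
    using abs_divide_le[OF d] by simp
  also have "?n0 + ?n1 * H_fun z - ?d * exp z = z^5 * p + ?n1 * (H_fun z - S) - ?d * (exp z - E)"
    unfolding poly[symmetric] by (simp add: field_simps)
  also have "\<bar>\<dots>\<bar> \<le> \<bar>z^5 * p\<bar> + \<bar>?n1 * (H_fun z - S)\<bar> + \<bar>?d * (exp z - E)\<bar>"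
    by (intro order_trans[OF abs_triangle_ineq4] order_trans[OF abs_triangle_ineq] add_mono order_refl)
  also have "\<dots> \<le> \<bar>z\<bar>^5 * 2 + 12 * \<bar>z\<bar>^5 + 12 * \<bar>z\<bar>^5"
    unfolding abs_mult power_abs
    using p n1 d' H_fun_Taylor_4[OF z] exp_Taylor_4[OF z]
    by (intro add_mono mult_mono) (auto simp: S_def E_def)
  also have "\<dots> \<le> 30 * \<bar>z\<bar>^5" by simp
  finally show ?thesis .
qed

text \<open>Telescoping, one factor at a time. Since \<open>1 \<le> b\<close>, the exponent on the
  right can stay \<open>n\<close>, which avoids a truncated \<open>n - 1\<close>.\<close>

lemma power_diff_le:
  fixes x y b :: real
  assumes "\<bar>x\<bar> \<le> b" "\<bar>y\<bar> \<le> b" "1 \<le> b"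
  shows "\<bar>x^n - y^n\<bar> \<le> real n * b^n * \<bar>x - y\<bar>"
proof (induction n)
  case (Suc n)
  have "x ^ Suc n - y ^ Suc n = x * (x^n - y^n) + (x - y) * y^n" by (simp add: algebra_simps)
  also have "\<bar>\<dots>\<bar> \<le> \<bar>x\<bar> * \<bar>x^n - y^n\<bar> + \<bar>x - y\<bar> * \<bar>y\<bar>^n"
    by (metis abs_mult abs_triangle_ineq power_abs)
  also have "\<dots> \<le> b * (real n * b^n * \<bar>x - y\<bar>) + \<bar>x - y\<bar> * b^Suc n"
  proof (intro add_mono mult_mono Suc assms order_refl)
    show "\<bar>y\<bar>^n \<le> b^Suc n"
      by (rule order_trans[OF power_mono power_increasing]) (use assms in auto)
  qed (use assms in auto)
  also have "\<dots> = real (Suc n) * b^Suc n * \<bar>x - y\<bar>" by (simp add: algebra_simps)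
  finally show ?case .
qed simp

text \<open>Consistency plus stability: \<open>n\<close> local errors of size
  \<open>(t * L)^5\<close> accumulate, amplified by at most \<open>b^n\<close>. Stability comes from
  consistency itself, because \<open>R_fun\<close> is a small perturbation of
  \<open>exp z \<le> 1\<close> when \<open>z\<close> lies in [-1, 0].\<close>

lemma R_fun_convergence:
  assumes C: "0 \<le> C" "C \<le> 1" and l: "-L \<le> l" "l \<le> 0" and t: "0 < t" "t * L \<le> 1"
    and n: "real n * t \<le> T"
  shows "\<bar>R_fun C (t * l) ^ n - exp (real n * (t * l))\<bar> \<le> 30 * exp (30 * T * L) * T * L^5 * t^4"
proof -
  define z where "z = t * l"
  have L: "0 \<le> L" using l by linarith
  have az: "\<bar>z\<bar> \<le> t * L"
    unfolding z_def abs_mult using l t by (intro mult_mono) auto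
  have z: "-1 \<le> z" "z \<le> 0" using az t l by (auto simp: z_def mult_le_0_iff)
  have cons: "\<bar>R_fun C z - exp z\<bar> \<le> 30 * \<bar>z\<bar>^5" by (rule R_fun_consistency[OF C z])
  \<comment> \<open>Consistency gives \<open>\<bar>R_fun C z\<bar> \<le> 1 + 30 * \<bar>z\<bar>^5
    \<le> 1 + 30 * (t * L)\<close>; the exponential form makes \<open>b^n\<close> depend on
    \<open>n * t\<close> only, hence bounded through \<open>T\<close>.\<close>
  define b where "b = exp (30 * (t * L))"
  have "\<bar>z\<bar>^5 \<le> \<bar>z\<bar>" using z power_decreasing[of 1 5 "\<bar>z\<bar>"] by simp
  moreover have "1 + 30 * (t * L) \<le> b" unfolding b_def by (rule exp_ge_add_one_self)
  moreover have "exp z \<le> 1" "0 < exp z" using z by auto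
  ultimately have b: "\<bar>R_fun C z\<bar> \<le> b" "\<bar>exp z\<bar> \<le> b" "1 \<le> b" using cons az by linarith+
  have "b^n = exp (30 * (real n * t) * L)"
    by (simp add: b_def exp_of_nat_mult[symmetric] mult_ac)
  also have "\<dots> \<le> exp (30 * T * L)" using n L by (simp add: mult_right_mono)
  finally have bn: "b^n \<le> exp (30 * T * L)" .
  have "\<bar>R_fun C z ^ n - exp z ^ n\<bar> \<le> real n * b^n * \<bar>R_fun C z - exp z\<bar>"
    by (rule power_diff_le[OF b])
  also have "\<dots> \<le> real n * exp (30 * T * L) * (30 * (t * L)^5)"
  proof (intro mult_mono bn order_refl)
    show "\<bar>R_fun C z - exp z\<bar> \<le> 30 * (t * L)^5"
      using cons power_mono[OF az, of 5] by simp
  qed (auto simp: b_def)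
  \<comment> \<open>One of the five factors \<open>t\<close> is paired with \<open>n\<close>,
    leaving order 4.\<close>
  also have "\<dots> = 30 * exp (30 * T * L) * (real n * t) * L^5 * t^4"
    by (simp add: power_mult_distrib eval_nat_numeral)
  also have "\<dots> \<le> 30 * exp (30 * T * L) * T * L^5 * t^4"
    using n L t by (intro mult_right_mono mult_left_mono) auto
  finally show ?thesis by (simp add: z_def exp_of_nat_mult)
qed

section \<open>Functions of an operator on sums of eigenvectors\<close>

lemma linear_sum_eigenvectors:
  assumes "linear M" and "\<And>i. i \<in> I \<Longrightarrow> M (u i) = \<mu> i *\<^sub>R u i"
  shows "M (\<Sum>i\<in>I. c i *\<^sub>R u i) = (\<Sum>i\<in>I. (c i * \<mu> i) *\<^sub>R u i)"
proof -
  have "M (\<Sum>i\<in>I. c i *\<^sub>R u i) = (\<Sum>i\<in>I. M (c i *\<^sub>R u i))" by (rule linear_sum[OF assms(1)])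
  also have "\<dots> = (\<Sum>i\<in>I. (c i * \<mu> i) *\<^sub>R u i)"
    by (intro sum.cong) (auto simp: linear_scale[OF assms(1)] assms(2))
  finally show ?thesis .
qed

text \<open>The \<open>inv\<close> in \<open>H_op\<close> is evaluated by exhibiting the preimage
  \<open>?y\<close>: the denominator polynomial maps it to the numerator applied to the sum, and
  injectivity cancels \<open>inv\<close>. General weights \<open>c\<close> are kept because
  \<open>R_op\<close> applies \<open>H_op\<close> to weighted sums.\<close>

lemma H_op_sum_eigenvectors:
  assumes lin: "linear M" and eig: "\<And>i. i \<in> I \<Longrightarrow> M (u i) = \<mu> i *\<^sub>R u i"
    and neg: "\<And>i. i \<in> I \<Longrightarrow> \<mu> i \<le> 0"
    and inj: "inj (\<lambda>u. u - (1/4) *\<^sub>R M u + (1/48) *\<^sub>R M (M u))"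
  shows "H_op M (\<Sum>i\<in>I. c i *\<^sub>R u i) = (\<Sum>i\<in>I. (c i * H_fun (\<mu> i)) *\<^sub>R u i)"
proof -
  have M: "M (\<Sum>i\<in>I. c i *\<^sub>R u i) = (\<Sum>i\<in>I. (c i * \<mu> i) *\<^sub>R u i)" for c
    by (intro linear_sum_eigenvectors lin eig)
  let ?Q = "\<lambda>u. u - (1/4) *\<^sub>R M u + (1/48) *\<^sub>R M (M u)"
  let ?s = "\<Sum>i\<in>I. c i *\<^sub>R u i" and ?y = "\<Sum>i\<in>I. (c i * H_fun (\<mu> i)) *\<^sub>R u i"
  \<comment> \<open>Both sides become combinations of the \<open>u i\<close>, so it suffices to
    compare coefficients, where the scalar denominator of \<open>H_fun\<close> is cleared.\<close>
  have "?s + (1/4) *\<^sub>R M ?s + (1/48) *\<^sub>R M (M ?s) = ?Q ?y"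
    unfolding M scaleR_sum_right sum.distrib[symmetric] sum_subtractf[symmetric] scaleR_scaleR
      scaleR_add_left[symmetric] scaleR_diff_left[symmetric]
  proof (intro sum.cong refl arg_cong2[where f = scaleR])
    fix i assume "i \<in> I"
    have h: "H_fun (\<mu> i) * (1 - \<mu> i/4 + (\<mu> i)\<^sup>2/48) = 1 + \<mu> i/4 + (\<mu> i)\<^sup>2/48"
      unfolding H_fun_def using H_denominator_ge_1[OF neg[OF \<open>i \<in> I\<close>]] by simp
    have "c i + 1/4 * (c i * \<mu> i) + 1/48 * (c i * \<mu> i * \<mu> i) = c i * (1 + \<mu> i/4 + (\<mu> i)\<^sup>2/48)"
      by (simp add: algebra_simps power2_eq_square)
    also have "\<dots> = c i * (H_fun (\<mu> i) * (1 - \<mu> i/4 + (\<mu> i)\<^sup>2/48))" by (simp only: h)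
    also have "\<dots> = c i * H_fun (\<mu> i) - 1/4 * (c i * H_fun (\<mu> i) * \<mu> i)
        + 1/48 * (c i * H_fun (\<mu> i) * \<mu> i * \<mu> i)"
      by (simp add: algebra_simps power2_eq_square)
    finally show "c i + 1/4 * (c i * \<mu> i) + 1/48 * (c i * \<mu> i * \<mu> i) = \<dots>" .
  qed
  then have "H_op M ?s = inv ?Q (?Q ?y)" unfolding H_op_def comp_def by (rule arg_cong)
  then show ?thesis using inv_f_f[OF inj, of ?y] by simp
qed

text \<open>The same preimage argument, one level up. Injectivity is assumed for all
  \<open>b\<close> and \<open>c\<close> so that it serves the inner denominator of
  \<open>H_op\<close> as well as the outer one.\<close>

lemma R_op_sum_eigenvectors:
  assumes lin: "linear M" and eig: "\<And>i. i \<in> I \<Longrightarrow> M (u i) = \<mu> i *\<^sub>R u i"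
    and neg: "\<And>i. i \<in> I \<Longrightarrow> \<mu> i \<le> 0" and C: "0 \<le> C"
    and inj: "\<And>b c. 0 < b \<Longrightarrow> 0 \<le> c \<Longrightarrow> inj (\<lambda>u. u - b *\<^sub>R M u + c *\<^sub>R M (M u))"
  shows "R_op C M (\<Sum>i\<in>I. c i *\<^sub>R u i) = (\<Sum>i\<in>I. (c i * R_fun C (\<mu> i)) *\<^sub>R u i)"
proof -
  have M: "M (\<Sum>i\<in>I. c i *\<^sub>R u i) = (\<Sum>i\<in>I. (c i * \<mu> i) *\<^sub>R u i)" for c
    by (intro linear_sum_eigenvectors lin eig)
  let ?Q = "\<lambda>u. u - a2 C *\<^sub>R M u + (3/2 * C) *\<^sub>R M (M u)"
  let ?s = "\<Sum>i\<in>I. c i *\<^sub>R u i" and ?y = "\<Sum>i\<in>I. (c i * R_fun C (\<mu> i)) *\<^sub>R u i"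
  have injQ: "inj ?Q" using C by (intro inj) (auto simp: a2_def)
  have H: "H_op M ?s = (\<Sum>i\<in>I. (c i * H_fun (\<mu> i)) *\<^sub>R u i)"
    by (intro H_op_sum_eigenvectors lin eig neg inj) auto
  have "?s + a0 C *\<^sub>R M ?s + C *\<^sub>R M (M ?s)
      + (a1 C *\<^sub>R M (H_op M ?s) - C *\<^sub>R M (M (H_op M ?s))) = ?Q ?y"
    unfolding H M scaleR_sum_right sum.distrib[symmetric] sum_subtractf[symmetric] scaleR_scaleR
      scaleR_add_left[symmetric] scaleR_diff_left[symmetric]
  proof (intro sum.cong refl arg_cong2[where f = scaleR])
    fix i assume "i \<in> I"
    let ?m = "\<mu> i" and ?R = "R_fun C (\<mu> i)" and ?h = "H_fun (\<mu> i)"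
    have h: "?R * (1 - a2 C * ?m + 3/2 * C * ?m\<^sup>2)
        = 1 + a0 C * ?m + C * ?m\<^sup>2 + (a1 C * ?m - C * ?m\<^sup>2) * ?h"
      unfolding R_fun_def using R_denominator_ge_1[OF C neg[OF \<open>i \<in> I\<close>]] by simp
    have "c i + a0 C * (c i * ?m) + C * (c i * ?m * ?m)
        + (a1 C * (c i * ?h * ?m) - C * (c i * ?h * ?m * ?m))
        = c i * (1 + a0 C * ?m + C * ?m\<^sup>2 + (a1 C * ?m - C * ?m\<^sup>2) * ?h)"
      by (simp add: algebra_simps power2_eq_square)
    also have "\<dots> = c i * (?R * (1 - a2 C * ?m + 3/2 * C * ?m\<^sup>2))" by (simp only: h)
    also have "\<dots> = c i * ?R - a2 C * (c i * ?R * ?m) + 3/2 * C * (c i * ?R * ?m * ?m)"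
      by (simp add: algebra_simps power2_eq_square)
    finally show "c i + a0 C * (c i * ?m) + C * (c i * ?m * ?m)
        + (a1 C * (c i * ?h * ?m) - C * (c i * ?h * ?m * ?m)) = \<dots>" .
  qed
  then have "R_op C M ?s = inv ?Q (?Q ?y)" unfolding R_op_def comp_def by (rule arg_cong)
  then show ?thesis using inv_f_f[OF injQ, of ?y] by simp
qed

lemma R_op_funpow_sum_eigenvectors:
  assumes "linear M" and "\<And>i. i \<in> I \<Longrightarrow> M (u i) = \<mu> i *\<^sub>R u i"
    and "\<And>i. i \<in> I \<Longrightarrow> \<mu> i \<le> 0" and "0 \<le> C"
    and "\<And>b c. 0 < b \<Longrightarrow> 0 \<le> c \<Longrightarrow> inj (\<lambda>u. u - b *\<^sub>R M u + c *\<^sub>R M (M u))"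
  shows "(R_op C M ^^ n) (\<Sum>i\<in>I. u i) = (\<Sum>i\<in>I. (R_fun C (\<mu> i) ^ n) *\<^sub>R u i)"
proof (induction n)
  case (Suc n)
  then show ?case
    by (simp add: R_op_sum_eigenvectors[OF assms] mult.commute)
qed simp

text \<open>Powers of \<open>M\<close> act on each \<open>u i\<close> as powers of
  \<open>\<mu> i\<close>, so the operator series is a finite sum of scalar exponential
  series.\<close>

lemma exp_op_sum_eigenvectors:
  fixes M :: "'v::real_normed_vector \<Rightarrow> 'v"
  assumes lin: "linear M" and eig: "\<And>i. i \<in> I \<Longrightarrow> M (u i) = \<mu> i *\<^sub>R u i"
  shows "exp_op M (\<Sum>i\<in>I. u i) = (\<Sum>i\<in>I. exp (\<mu> i) *\<^sub>R u i)"
proof -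
  have pow: "(M ^^ n) (\<Sum>i\<in>I. u i) = (\<Sum>i\<in>I. (\<mu> i ^ n) *\<^sub>R u i)" for n
    by (induction n) (simp_all add: linear_sum_eigenvectors[OF lin eig] mult.commute)
  have "(\<lambda>n. \<Sum>i\<in>I. (\<mu> i ^ n /\<^sub>R fact n) *\<^sub>R u i) sums (\<Sum>i\<in>I. exp (\<mu> i) *\<^sub>R u i)"
    by (intro sums_sum bounded_linear.sums[OF bounded_linear_scaleR_left] exp_converges)
  also have "(\<lambda>n. \<Sum>i\<in>I. (\<mu> i ^ n /\<^sub>R fact n) *\<^sub>R u i)
      = (\<lambda>n. (1 / fact n) *\<^sub>R (M ^^ n) (\<Sum>i\<in>I. u i))"
    by (simp add: pow scaleR_sum_right divide_inverse)
  finally show ?thesis unfolding exp_op_def by (rule sums_unique[symmetric])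
qed

section \<open>Invertibility of the denominators\<close>

lemma inj_quadratic_dissipative:
  fixes M :: "'v::real_vector \<Rightarrow> 'v" and e :: "'v \<Rightarrow> 'v \<Rightarrow> real"
  assumes lin: "linear M" and bil: "\<And>y. linear (\<lambda>u. e u y)"
    and def: "\<And>u. e u u \<le> 0 \<Longrightarrow> u = 0" and diss: "\<And>u. e (M u) u \<le> 0"
    and sym: "\<And>u y. e u y = e y u"
    and b: "0 < b" and c: "0 \<le> c"
  shows "inj (\<lambda>u. u - b *\<^sub>R M u + c *\<^sub>R M (M u))"
proof -
  let ?Q = "\<lambda>u. u - b *\<^sub>R M u + c *\<^sub>R M (M u)"
  have linQ: "linear ?Q"
    by (rule linearI)
      (simp_all add: linear_add[OF lin] linear_scale[OF lin] algebra_simps)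
  have "u = 0" if "?Q u = 0" for u
  proof -
    \<comment> \<open>The equation is tested with \<open>M u\<close> rather than \<open>u\<close>:
      then the linear and quadratic contributions are controlled by dissipativity at
      \<open>u\<close> and at \<open>M u\<close>, while testing with \<open>u\<close> would leave
      \<open>e (M (M u)) u\<close> without a sign.\<close>
    have "0 = e (?Q u) (M u)" by (simp add: that linear_0[OF bil])
    also have "\<dots> = e u (M u) - b * e (M u) (M u) + c * e (M (M u)) (M u)"
      by (simp add: linear_add[OF bil] linear_diff[OF bil] linear_scale[OF bil])
    finally have "b * e (M u) (M u) = e (M u) u + c * e (M (M u)) (M u)"
      by (simp add: sym[of u])
    also have "\<dots> \<le> 0"
      using diss[of u] diss[of "M u"] c by (simp add: add_nonpos_nonpos mult_nonneg_nonpos)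
    finally have "e (M u) (M u) \<le> 0" using b by (simp add: mult_le_0_iff)
    then have "M u = 0" by (rule def)
    with that show "u = 0" by (simp add: linear_0[OF lin])
  qed
  then show ?thesis using linear_injective_0[OF linQ] by blast
qed

lemma linear_A_op:
  assumes "compatible_discretization G D a"
  shows "linear (A_op G D a \<delta>)"
proof -
  have G: "linear G" and D: "linear D" using assms by (auto simp: compatible_discretization_def)
  show ?thesis
    by (rule linearI)
      (auto simp: A_op_def linear_add[OF G] linear_add[OF D] linear_scale[OF G] linear_scale[OF D]
        algebra_simps)
qed

lemma inj_quadratic_A_op:
  assumes comp: "compatible_discretization G D a" and \<delta>: "0 < \<delta>" and t: "0 < t"
    and bc: "0 < b" "0 \<le> c"
  defines "M \<equiv> \<lambda>u. t *\<^sub>R A_op G D a \<delta> u"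
  shows "inj (\<lambda>u. u - b *\<^sub>R M u + c *\<^sub>R M (M u))"
proof -
  have G: "linear G" and a: "0 < a" and D: "D = (\<lambda>q. - adjoint G q)"
    using comp by (auto simp: compatible_discretization_def)
  \<comment> \<open>The weight \<open>a / \<delta>\<close> makes the two coupling terms in
    \<open>?e (M u) u\<close> cancel, since \<open>D\<close> is minus the adjoint of
    \<open>G\<close>; only the damping of \<open>q\<close> remains.\<close>
  let ?e = "\<lambda>u y. a / \<delta> * (fst u \<bullet> fst y) + snd u \<bullet> snd y"
  show ?thesis
  proof (rule inj_quadratic_dissipative[where e = ?e])
    show "linear M" unfolding M_def by (intro linear_compose_scale_right linear_A_op comp)
    show "linear (\<lambda>u. ?e u y)" for y
      by (rule linearI) (simp_all add: inner_add_left algebra_simps)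
    show "u = 0" if "?e u u \<le> 0" for u
    proof -
      have "0 \<le> a / \<delta> * (fst u \<bullet> fst u)" using a \<delta> by simp
      then have "a / \<delta> * (fst u \<bullet> fst u) = 0" "snd u \<bullet> snd u = 0"
        using that inner_ge_zero[of "snd u"] by linarith+
      then show "u = 0" using a \<delta> by (simp add: prod_eq_iff)
    qed
    show "?e (M u) u \<le> 0" for u
    proof -
      obtain x q where u: "u = (x, q)" by (cases u)
      have "?e (M u) u = - (t / \<delta>) * (q \<bullet> q)"
        using adjoint_works[OF G, of x q]
        by (simp add: M_def u A_op_def D inner_diff_left inner_commute algebra_simps)
      then show ?thesis using t \<delta> by (simp add: mult_nonneg_nonneg)
    qed
  qed (use bc in \<open>auto simp: inner_commute\<close>)
qed

section \<open>The slow eigenvalue and eigenvector of a coupled block\<close>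

lemma lambda_slow_bounds:
  assumes "0 < \<delta>" "0 < a" "4 * a * \<delta> * s\<^sup>2 < 1"
  shows "- (2 * a * s\<^sup>2) \<le> lambda_slow a \<delta> s" "lambda_slow a \<delta> s \<le> 0"
proof -
  define y where "y = 4 * a * \<delta> * s\<^sup>2"
  have y: "0 \<le> y" "y < 1" using assms by (auto simp: y_def)
  \<comment> \<open>On [0, 1] the square root lies above the identity. Hence the numerator of
    \<open>lambda_slow\<close> is at least \<open>- y\<close>, and the factor
    \<open>\<delta>\<close> in \<open>y\<close> cancels the one in the denominator.\<close>
  have "(1 - y)\<^sup>2 \<le> 1 - y" using y by (simp add: power2_eq_square mult_left_le)
  then have "1 - y \<le> sqrt (1 - y)" using real_le_rsqrt by blast
  moreover have "- (2 * a * s\<^sup>2) = - y / (2 * \<delta>)" using assms by (simp add: y_def field_simps)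
  ultimately show "- (2 * a * s\<^sup>2) \<le> lambda_slow a \<delta> s"
    using assms unfolding lambda_slow_def y_def[symmetric]
    by (simp only:) (rule divide_right_mono, auto)
  have "sqrt (1 - y) \<le> 1" using y by simp
  then show "lambda_slow a \<delta> s \<le> 0"
    using assms unfolding lambda_slow_def y_def[symmetric] by (simp add: divide_nonpos_pos)
qed

text \<open>The spectral gap \<open>?l - ?f\<close> is nonzero, so multiplying the fixed-point
  equation by it gives \<open>(B - ?f) x = (?l - ?f) x\<close>, that is \<open>B x = ?l x\<close>
  for the block \<open>B\<close>; the conclusions are the two components.\<close>

lemma slow_projector_eigen:
  assumes \<delta>: "0 < \<delta>" and s: "4 * a * \<delta> * s\<^sup>2 < 1"
    and fix_c: "slow_projector a \<delta> s *v vector [c, d] = vector [c, d]"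
  shows "s * d = lambda_slow a \<delta> s * c"
    and "- (a * s / \<delta>) * c - (1 / \<delta>) * d = lambda_slow a \<delta> s * d"
proof -
  let ?l = "lambda_slow a \<delta> s" and ?f = "lambda_fast a \<delta> s"
  have "?l - ?f = sqrt (1 - 4 * a * \<delta> * s\<^sup>2) / \<delta>"
    using \<delta> by (simp add: lambda_slow_def lambda_fast_def diff_divide_distrib[symmetric])
  then have ne: "?l - ?f \<noteq> 0" using \<delta> s by simp
  have "(block a \<delta> s - ?f *\<^sub>R mat 1) *v vector [c, d]
      = (?l - ?f) *\<^sub>R (slow_projector a \<delta> s *v vector [c, d])"
    unfolding slow_projector_def using ne by (simp add: scaleR_matrix_vector_assoc[symmetric])
  then have eq: "(block a \<delta> s - ?f *\<^sub>R mat 1) *v vector [c, d] = (?l - ?f) *\<^sub>R vector [c, d]"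
    by (simp only: fix_c)
  from arg_cong[OF eq, of "\<lambda>x. x $ 1"] show "s * d = ?l * c"
    by (simp add: block_def matrix_vector_mult_def mat_def sum_2 algebra_simps)
  from arg_cong[OF eq, of "\<lambda>x. x $ 2"] show "- (a * s / \<delta>) * c - (1 / \<delta>) * d = ?l * d"
    by (simp add: block_def matrix_vector_mult_def mat_def sum_2 algebra_simps)
qed

section \<open>Splitting slow data along the singular vectors\<close>

lemma sum_inner_orthonormal:
  fixes f :: "nat \<Rightarrow> 'v::real_inner"
  assumes on: "\<And>i j. i < r \<Longrightarrow> j < r \<Longrightarrow> f i \<bullet> f j = (if i = j then 1 else 0)" and "j < r"
  shows "(\<Sum>i<r. c i *\<^sub>R f i) \<bullet> f j = c j"
proof -
  have "(\<Sum>i<r. c i *\<^sub>R f i) \<bullet> f j = (\<Sum>i<r. if i = j then c i else 0)"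
    unfolding inner_sum_left by (intro sum.cong) (use assms in auto)
  then show ?thesis using \<open>j < r\<close> by simp
qed

lemma svd_apply:
  assumes "is_svd G r \<sigma> v w" "linear G" "j < r"
  shows "G (v j) = \<sigma> j *\<^sub>R w j" and "adjoint G (w j) = \<sigma> j *\<^sub>R v j"
proof -
  have ov: "\<And>i j. i < r \<Longrightarrow> j < r \<Longrightarrow> v i \<bullet> v j = (if i = j then 1 else 0)"
    and ow: "\<And>i j. i < r \<Longrightarrow> j < r \<Longrightarrow> w i \<bullet> w j = (if i = j then 1 else 0)"
    and rep: "\<And>x. G x = (\<Sum>j<r. (\<sigma> j * (x \<bullet> v j)) *\<^sub>R w j)"
    using assms(1) by (auto simp: is_svd_def)
  have "G (v j) = (\<Sum>i<r. if i = j then \<sigma> i *\<^sub>R w i else 0)"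
    unfolding rep by (intro sum.cong) (use ov \<open>j < r\<close> in auto)
  then show "G (v j) = \<sigma> j *\<^sub>R w j" using \<open>j < r\<close> by simp
  have "x \<bullet> adjoint G (w j) = x \<bullet> (\<sigma> j *\<^sub>R v j)" for x
    using sum_inner_orthonormal[OF ow \<open>j < r\<close>, of "\<lambda>i. \<sigma> i * (x \<bullet> v i)"]
    by (simp add: adjoint_works[OF assms(2)] rep)
  then show "adjoint G (w j) = \<sigma> j *\<^sub>R v j" using vector_eq_ldot by blast
qed

text \<open>Removing the projection onto the singular vectors kills every coefficient in the
  expansion of \<open>G\<close>. For the adjoint, the same is seen by testing against an arbitrary
  \<open>y\<close>.\<close>

lemma svd_kernels:
  assumes svd: "is_svd G r \<sigma> v w" and G: "linear G"
  shows "G (x - (\<Sum>j<r. (x \<bullet> v j) *\<^sub>R v j)) = 0"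
    and "adjoint G (q - (\<Sum>j<r. (q \<bullet> w j) *\<^sub>R w j)) = 0"
proof -
  have ov: "\<And>i j. i < r \<Longrightarrow> j < r \<Longrightarrow> v i \<bullet> v j = (if i = j then 1 else 0)"
    and ow: "\<And>i j. i < r \<Longrightarrow> j < r \<Longrightarrow> w i \<bullet> w j = (if i = j then 1 else 0)"
    and rep: "\<And>x. G x = (\<Sum>j<r. (\<sigma> j * (x \<bullet> v j)) *\<^sub>R w j)"
    using svd by (auto simp: is_svd_def)
  show "G (x - (\<Sum>j<r. (x \<bullet> v j) *\<^sub>R v j)) = 0"
    unfolding rep by (intro sum.neutral) (auto simp: inner_diff_left sum_inner_orthonormal[OF ov])
  have "y \<bullet> adjoint G (q - (\<Sum>j<r. (q \<bullet> w j) *\<^sub>R w j)) = 0" for y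
    unfolding adjoint_works[OF G] rep inner_sum_left
    by (intro sum.neutral)
      (auto simp: inner_diff_right inner_commute[of "w _"] sum_inner_orthonormal[OF ow])
  then show "adjoint G (q - (\<Sum>j<r. (q \<bullet> w j) *\<^sub>R w j)) = 0" by (metis inner_eq_zero_iff)
qed

text \<open>Each coupled block contributes one slow eigenvector, and the kernel part of
  \<open>fst U\<close> contributes one more with eigenvalue 0. The norm bounds contain no
  \<open>\<delta>\<close>, which keeps the final constant uniform.\<close>

lemma slow_data_eigenvectors:
  assumes comp: "compatible_discretization G D a" and svd: "is_svd G r \<sigma> v w" and \<delta>: "0 < \<delta>"
    and small: "\<forall>j<r. 4 * a * \<delta> * (\<sigma> j)\<^sup>2 < 1"
    and slow: "slow_data G r \<sigma> v w a \<delta> U"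
  obtains u where "U = (\<Sum>i\<le>r. u i)"
    and "\<And>i. i \<le> r \<Longrightarrow> A_op G D a \<delta> (u i)
           = (if i < r then lambda_slow a \<delta> (\<sigma> i) else 0) *\<^sub>R u i"
    and "\<And>i. i \<le> r \<Longrightarrow> norm (u i) \<le> (1 + 2 * real r) * norm U"
proof -
  have G: "linear G" and a: "0 < a" and D: "D = (\<lambda>q. - adjoint G q)"
    using comp by (auto simp: compatible_discretization_def)
  have adj: "linear (adjoint G)" by (rule adjoint_linear[OF G])
  have ov: "\<And>i j. i < r \<Longrightarrow> j < r \<Longrightarrow> v i \<bullet> v j = (if i = j then 1 else 0)"
    and ow: "\<And>i j. i < r \<Longrightarrow> j < r \<Longrightarrow> w i \<bullet> w j = (if i = j then 1 else 0)"
    using svd by (auto simp: is_svd_def)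
  define c where "c j = fst U \<bullet> v j" for j
  define d where "d j = snd U \<bullet> w j" for j
  define x0 where "x0 = fst U - (\<Sum>j<r. c j *\<^sub>R v j)"
  \<comment> \<open>Index \<open>r\<close> is reserved for the component in the kernel of
    \<open>G\<close>.\<close>
  define u where "u i = (if i < r then (c i *\<^sub>R v i, d i *\<^sub>R w i) else (x0, 0))" for i
  \<comment> \<open>The absence of a transverse component enters here: the residual \<open>q\<close>
    lies in the kernel of the adjoint, so it is orthogonal to \<open>snd U\<close> and to all
    \<open>w j\<close>, hence to itself.\<close>
  have sndU: "snd U = (\<Sum>j<r. d j *\<^sub>R w j)"
  proof -
    define q where "q = snd U - (\<Sum>j<r. d j *\<^sub>R w j)"
    have "adjoint G q = 0" unfolding q_def d_def by (rule svd_kernels(2)[OF svd G])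
    then have "snd U \<bullet> q = 0"
      using slow by (auto simp: slow_data_def orthogonal_comp_def orthogonal_def inner_commute)
    moreover have "w j \<bullet> q = 0" if "j < r" for j
      using sum_inner_orthonormal[OF ow that, of d]
      by (simp add: q_def inner_diff_right d_def inner_commute)
    then have "(\<Sum>j<r. d j *\<^sub>R w j) \<bullet> q = 0" by (simp add: inner_sum_left)
    ultimately have "q \<bullet> q = 0" by (simp add: q_def inner_diff_left)
    then show ?thesis by (simp add: q_def)
  qed
  have sum_u: "(\<Sum>i<r. u i) = (\<Sum>j<r. c j *\<^sub>R v j, \<Sum>j<r. d j *\<^sub>R w j)"
    by (simp add: u_def prod_eq_iff fst_sum snd_sum)
  have U: "U = (\<Sum>i\<le>r. u i)"
    unfolding lessThan_Suc_atMost[symmetric] sum.lessThan_Suc sum_u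
    by (simp add: u_def x0_def prod_eq_iff sndU)
  have eig: "A_op G D a \<delta> (u i) = (if i < r then lambda_slow a \<delta> (\<sigma> i) else 0) *\<^sub>R u i"
    if "i \<le> r" for i
  proof (cases "i < r")
    case True
    have "slow_projector a \<delta> (\<sigma> i) *v vector [c i, d i] = vector [c i, d i]"
      using slow True by (auto simp: slow_data_def c_def d_def)
    note e = slow_projector_eigen[OF \<delta> small[rule_format, OF True] this]
    have "- (a / \<delta>) *\<^sub>R (c i *\<^sub>R \<sigma> i *\<^sub>R w i) - (1 / \<delta>) *\<^sub>R (d i *\<^sub>R w i)
        = (lambda_slow a \<delta> (\<sigma> i) * d i) *\<^sub>R w i"
      unfolding e(2)[symmetric] by (simp add: algebra_simps)
    then show ?thesis
      using True e(1)
      by (simp add: u_def A_op_def D linear_scale[OF G] linear_scale[OF adj] svd_apply[OF svd G]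
          mult.commute)
  next
    case False
    have "G x0 = 0" unfolding x0_def c_def by (rule svd_kernels(1)[OF svd G])
    then show ?thesis using False by (simp add: u_def A_op_def D linear_0[OF adj])
  qed
  have nv: "norm (v i) = 1" "norm (w i) = 1" if "i < r" for i
    using ov[OF that that] ow[OF that that] by (simp_all add: norm_eq_1)
  have nu: "norm (u i) \<le> 2 * norm U" if "i < r" for i
  proof -
    have "norm (u i) \<le> norm (c i *\<^sub>R v i) + norm (d i *\<^sub>R w i)"
      using that norm_Pair_le[of "c i *\<^sub>R v i" "d i *\<^sub>R w i"] by (simp add: u_def)
    also have "\<dots> = \<bar>c i\<bar> + \<bar>d i\<bar>" using that by (simp add: nv)
    also have "\<dots> \<le> norm (fst U) + norm (snd U)"
      using Cauchy_Schwarz_ineq2[of "fst U" "v i"] Cauchy_Schwarz_ineq2[of "snd U" "w i"] that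
      by (simp add: c_def d_def nv)
    also have "\<dots> \<le> 2 * norm U"
      using norm_fst_le[of "fst U" "snd U"] norm_snd_le[of "snd U" "fst U"] by simp
    finally show ?thesis .
  qed
  have "norm (u i) \<le> (1 + 2 * real r) * norm U" if "i \<le> r" for i
  proof (cases "i < r")
    case True
    then have "2 * norm U \<le> (1 + 2 * real r) * norm U" by (intro mult_right_mono) auto
    with nu[OF True] show ?thesis by linarith
  next
    case False
    \<comment> \<open>The kernel component is what remains of \<open>U\<close> after
      \<open>r\<close> components of norm at most \<open>2 * norm U\<close> are removed; this
      produces the factor \<open>1 + 2 * real r\<close>.\<close>
    then have "u i = U - (\<Sum>i<r. u i)"
      using that U by (simp add: lessThan_Suc_atMost[symmetric])
    then have "norm (u i) \<le> norm U + norm (\<Sum>i<r. u i)" by (simp add: norm_triangle_ineq4)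
    also have "norm (\<Sum>i<r. u i) \<le> (\<Sum>i<r. 2 * norm U)"
      by (intro sum_norm_le nu) auto
    finally show ?thesis by (simp add: algebra_simps)
  qed
  with U eig show thesis using that by blast
qed

section \<open>Uniform constants and conclusion\<close>

lemma C_range:
  assumes "C \<in> {C_minus..C_plus}"
  shows "0 \<le> C" "C \<le> 1"
proof -
  have "sqrt 105 \<le> 25" by (rule real_le_lsqrt) auto
  then show "0 \<le> C" "C \<le> 1" using assms by (auto simp: C_minus_def C_plus_def)
qed

lemma sigma_le_sigma_max: "j < r \<Longrightarrow> \<sigma> j \<le> sigma_max r \<sigma>"
  unfolding sigma_max_def by (intro Max_ge) auto

theorem theorem6:
  fixes G :: "'x::euclidean_space \<Rightarrow> 'q::euclidean_space"
    and D :: "'q \<Rightarrow> 'x"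
    and a \<delta>0 C T :: real
    and r :: nat and \<sigma> :: "nat \<Rightarrow> real" and v :: "nat \<Rightarrow> 'x" and w :: "nat \<Rightarrow> 'q"
  assumes "compatible_discretization G D a"
    and "is_svd G r \<sigma> v w"
    and "0 < \<delta>0" and "4 * a * \<delta>0 * (sigma_max r \<sigma>)\<^sup>2 < 1"
    and "C \<in> {C_minus..C_plus}"
    and "0 < T"
  shows "\<exists>K \<Delta>0. 0 < \<Delta>0 \<and>
    (\<forall>U :: real \<Rightarrow> 'x \<times> 'q.
       (\<forall>\<delta>\<in>{0<..\<delta>0}. slow_data G r \<sigma> v w a \<delta> (U \<delta>)) \<longrightarrow>
       bounded (U ` {0<..\<delta>0}) \<longrightarrow>
       (\<forall>\<delta>\<in>{0<..\<delta>0}. \<forall>\<Delta>t\<in>{0<..\<Delta>0}. \<forall>n::nat. real n * \<Delta>t \<le> T \<longrightarrow>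
          norm ((R_op C (\<lambda>u. \<Delta>t *\<^sub>R A_op G D a \<delta> u) ^^ n) (U \<delta>)
                - exp_op (\<lambda>u. (real n * \<Delta>t) *\<^sub>R A_op G D a \<delta> u) (U \<delta>))
            \<le> K * \<Delta>t ^ 4 * norm (U \<delta>)))"
proof -
  note comp = assms(1) and svd = assms(2)
  have a: "0 < a" using comp by (auto simp: compatible_discretization_def)
  note C = C_range[OF assms(5)]
  \<comment> \<open>A bound for the moduli of all slow eigenvalues, uniform in
    \<open>\<delta>\<close>.\<close>
  define L where "L = 2 * a * (sigma_max r \<sigma>)\<^sup>2"
  have L: "0 \<le> L" using a by (simp add: L_def)
  define k where "k = 30 * exp (30 * T * L) * T * L^5"
  \<comment> \<open>There are \<open>1 + r\<close> components, each of norm at most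
    \<open>(1 + 2 * real r) * norm U\<close> and each with scalar error at most
    \<open>k * t^4\<close>.\<close>
  define K where "K = (1 + real r) * (1 + 2 * real r) * k"
  \<comment> \<open>Ensures \<open>t * L \<le> 1\<close>; the added 1 keeps the quotient meaningful
    when \<open>L = 0\<close>, that is when \<open>G = 0\<close>.\<close>
  define \<Delta>0 where "\<Delta>0 = 1 / (1 + L)"
  have "0 < \<Delta>0" using L by (simp add: \<Delta>0_def)
  \<comment> \<open>With \<open>K\<close> and \<open>\<Delta>0\<close> fixed in advance, the
    estimate can be proved for one \<open>\<delta>\<close> and one datum at a time.\<close>
  moreover have "norm ((R_op C (\<lambda>u. t *\<^sub>R A_op G D a \<delta> u) ^^ n) U
        - exp_op (\<lambda>u. (real n * t) *\<^sub>R A_op G D a \<delta> u) U) \<le> K * t ^ 4 * norm U"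
    if \<delta>: "\<delta> \<in> {0<..\<delta>0}" and slow: "slow_data G r \<sigma> v w a \<delta> U"
      and t: "t \<in> {0<..\<Delta>0}" and n: "real n * t \<le> T" for \<delta> t n U
  proof -
    have \<delta>': "0 < \<delta>" "\<delta> \<le> \<delta>0" and t': "0 < t" using \<delta> t by auto
    have "t * L \<le> \<Delta>0 * L" using t L by (intro mult_right_mono) auto
    also have "\<dots> \<le> 1" using L by (simp add: \<Delta>0_def)
    finally have tL: "t * L \<le> 1" .
    have sq: "(\<sigma> j)\<^sup>2 \<le> (sigma_max r \<sigma>)\<^sup>2" if "j < r" for j
      using svd that sigma_le_sigma_max[OF that, of \<sigma>]
      by (intro power_mono) (auto simp: is_svd_def intro: less_imp_le)
    have small: "\<forall>j<r. 4 * a * \<delta> * (\<sigma> j)\<^sup>2 < 1"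
    proof (intro allI impI)
      fix j assume "j < r"
      have "4 * a * \<delta> * (\<sigma> j)\<^sup>2 \<le> 4 * a * \<delta>0 * (sigma_max r \<sigma>)\<^sup>2"
        using a \<delta>' sq[OF \<open>j < r\<close>] by (intro mult_mono) auto
      with assms(4) show "4 * a * \<delta> * (\<sigma> j)\<^sup>2 < 1" by linarith
    qed
    define \<mu> where "\<mu> i = (if i < r then lambda_slow a \<delta> (\<sigma> i) else 0)" for i
    obtain u where U: "U = (\<Sum>i\<le>r. u i)"
      and eig: "\<And>i. i \<le> r \<Longrightarrow> A_op G D a \<delta> (u i) = \<mu> i *\<^sub>R u i"
      and nu: "\<And>i. i \<le> r \<Longrightarrow> norm (u i) \<le> (1 + 2 * real r) * norm U"
      unfolding \<mu>_def by (rule slow_data_eigenvectors[OF comp svd \<delta>'(1) small slow]) blast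
    have \<mu>: "- L \<le> \<mu> i" "\<mu> i \<le> 0" for i
    proof -
      have "a * (\<sigma> i)\<^sup>2 \<le> a * (sigma_max r \<sigma>)\<^sup>2" if "i < r"
        using a sq[OF that] by simp
      then show "- L \<le> \<mu> i" "\<mu> i \<le> 0"
        using lambda_slow_bounds[OF \<delta>'(1) a, of "\<sigma> i"] small L by (auto simp: \<mu>_def L_def)
    qed
    have lin: "linear (\<lambda>u. s *\<^sub>R A_op G D a \<delta> u)" for s
      by (intro linear_compose_scale_right linear_A_op comp)
    have R: "(R_op C (\<lambda>u. t *\<^sub>R A_op G D a \<delta> u) ^^ n) U = (\<Sum>i\<le>r. (R_fun C (t * \<mu> i) ^ n) *\<^sub>R u i)"
      unfolding U using t' \<mu>(2)
      by (intro R_op_funpow_sum_eigenvectors lin C inj_quadratic_A_op[OF comp \<delta>'(1)])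
        (auto simp: eig mult_nonneg_nonpos)
    have E: "exp_op (\<lambda>u. (real n * t) *\<^sub>R A_op G D a \<delta> u) U
        = (\<Sum>i\<le>r. exp (real n * (t * \<mu> i)) *\<^sub>R u i)"
      unfolding U by (intro exp_op_sum_eigenvectors lin) (auto simp: eig mult.assoc)
    have "norm ((\<Sum>i\<le>r. (R_fun C (t * \<mu> i) ^ n) *\<^sub>R u i) - (\<Sum>i\<le>r. exp (real n * (t * \<mu> i)) *\<^sub>R u i))
        \<le> (\<Sum>i\<le>r. k * t^4 * ((1 + 2 * real r) * norm U))"
      unfolding sum_subtractf[symmetric] scaleR_diff_left[symmetric]
    proof (intro sum_norm_le)
      fix i assume "i \<in> {..r}"
      have "\<bar>R_fun C (t * \<mu> i) ^ n - exp (real n * (t * \<mu> i))\<bar> \<le> k * t^4"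
        unfolding k_def by (rule R_fun_convergence[OF C \<mu> t' tL n])
      then show "norm ((R_fun C (t * \<mu> i) ^ n - exp (real n * (t * \<mu> i))) *\<^sub>R u i)
          \<le> k * t^4 * ((1 + 2 * real r) * norm U)"
        unfolding norm_scaleR using nu[of i] \<open>i \<in> {..r}\<close>
        by (intro mult_mono) (auto intro: order_trans[OF abs_ge_zero])
    qed
    then show ?thesis unfolding R E by (simp add: K_def algebra_simps)
  qed
  ultimately show ?thesis by blast
qed

end
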